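(* Let $f:\mathbb{R}^n\to\mathbb{R}$ be locally Lipschitz continuous, let $\tilde f$ be a smoothing function of $f$, and let $\nabla_x\tilde f(x,\xi,\mu)$ denote stochastic gradient estimates of $\nabla_x \tilde f(x,\mu)$. Suppose that: (1) $\mathbb{E}_\xi[\nabla_x\tilde f(x,\xi,\mu)]=\nabla_x\tilde f(x,\mu)$ for all $x\in\mathbb{R}^n$, $\mu>0$; (2) there is $G>0$ with $\mathbb{E}_\xi[\|\nabla_x\tilde f(x,\xi,\mu)\|^2]\le G^2/\mu^2$ for all $x\in\mathbb{R}^n$, $\mu>0$; (3) there is $C>0$ with $|f(x)-\tilde f(x,\mu)|\le C\mu$ for all $x\in\mathbb{R}^n$, $\mu>0$; (4) there is $C_0>0$ such that for all $\mu>0$ the gradient $\nabla_x\tilde f(\cdot,\mu)$ is Lipschitz continuous on $\mathbb{R}^n$ with constant $C_0/\mu$; (5) there is $C_1>0$ such that $|\tilde f(x,\mu')-\tilde f(x,\mu)|\le C_1|\mu'-\mu|$ for all $x\in\mathbb{R}^n$ and all $\mu,\mu'>0$; (6) there are constants $E_1,E_2>0$ such that for all $x\in\mathbb{R}^n$ and all $\mu>0$ there exist $y\in\mathcal{B}(x,E_1\mu)$ and a subgradient $g(y)\in\partial f(y)$ with $\|\nabla_x\tilde f(x,\mu)-g(y)\|\le E_2\mu$. Let $d\in(1,7/5]$ and $b\in(1/d,1)$, and let the smoothing stochastic gradient (SSG) method run with stepsizes $\alpha_k=k^{-b}$ (so that $\sum_{k=1}^\infty\alpha_k=\infty$ and $\sum_{k=1}^\infty\alpha_k^d<\infty$)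 and smoothing parameters $\mu_k=\alpha_k^{-\frac d3+\frac23}$. For each $k$ let $y_k\in\mathcal{B}(x_k,E_1\mu_k)$ and let $g(y_k)\in\partial f(y_k)$ be a subgradient satisfying $\|\nabla_x\tilde f(x_k,\mu_k)-g(y_k)\|\le E_2\mu_k$. Then $$\min_{1\le k\le T}\mathbb{E}\left[\|g(y_k)\|^2\right]=\mathcal{O}\bigl(T^{-r+\varepsilon}\bigr),$$ where $r=\min\left\{1-b,\ \frac{2b(2-d)}{3}\right\}$ and $\varepsilon$ is any positive number. Moreover, the best convergence rate of this bound (over the admissible choices of $d$ and $b$) can be arbitrarily close to the order of $T^{-2/7+\varepsilon}$.
   Context: The problem considered is $\min_{x\in\mathbb{R}^n} f(x)$, with $f$ possibly non-smooth and non-convex. Smoothing function: for a locally Lipschitz continuous $f:\mathbb{R}^n\to\mathbb{R}$, a function $\tilde f:\mathbb{R}^n\times[0,+\infty)\to\mathbb{R}$ is a smoothing function of $f$ if for every $\mu>0$, $\tilde f(\cdot,\mu)$ is continuously differentiable on $\mathbb{R}^n$, and for every $x\in\mathbb{R}^n$, $\lim_{z\to x,\,\mu\downarrow 0}\tilde f(z,\mu)=f(x)$. Here $\nabla_x\tilde f(x,\mu)$ is the gradient of $\tilde f(\cdot,\mu)$ at $x$. $\partial f$ denotes the Clarke subdifferential of $f$, and $\mathcal{B}(x,\rho)$ the ball of radius $\rho$ centered at $x$. $\xi$ is a random vector. For each $x$, each $\mu>0$ and each realization of $\xi$, $\nabla_x\tilde f(x,\xi,\mu)\in\mathbb{R}^n$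 is a stochastic gradient estimate; $\mathbb{E}_\xi$ is the expectation with respect to the distribution of $\xi$. SSG method: given an initial point $x_1$, positive stepsizes $\{\alpha_k\}$ and positive smoothing parameters $\{\mu_k\}$ with $\mu_{k+1}\le\mu_k$, for $k=1,2,\dots$ generate a realization $\xi_k$ of $\xi$ and set $x_{k+1}=x_k-\alpha_k\nabla_x\tilde f(x_k,\xi_k,\mu_k)$. $\mathbb{E}$ denotes the total expectation over the randomness of the method, and $T$ is the number of iterations.
   Formalization: The formal theorem additionally assumes that f is bounded below; without this the claim fails, e.g. for f(x) = -(1+x^2)^(1/4) with smoothing function -(1+μ^4+x^2)^(1/4), d = 7/5, b > 5/7 and no noise. *)

theory Defs
  imports "HOL-Probability.Probability" "HOL-Library.Landau_Symbols"
begin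

definition locally_lipschitz :: "('a::metric_space \<Rightarrow> 'b::metric_space) \<Rightarrow> bool" where
  "locally_lipschitz f \<longleftrightarrow> (\<forall>x. \<exists>\<rho>>0. \<exists>L. L-lipschitz_on (ball x \<rho>) f)"

definition gradient :: "('a::real_inner \<Rightarrow> real) \<Rightarrow> 'a \<Rightarrow> 'a" where
  "gradient f x = (THE D. GDERIV f x :> D)"

(* The filter nhds x is not punctured: y = x is allowed in the upper limit. *)
definition clarke_dderiv :: "('a::real_inner \<Rightarrow> real) \<Rightarrow> 'a \<Rightarrow> 'a \<Rightarrow> ereal" where
  "clarke_dderiv f x v =
     Limsup (nhds x \<times>\<^sub>F at_right 0) (\<lambda>(y, t). ereal ((f (y + t *\<^sub>R v) - f y) / t))"

definition clarke_subdifferential :: "('a::real_inner \<Rightarrow> real) \<Rightarrow> 'a \<Rightarrow> 'a set" where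
  "clarke_subdifferential f x = {g. \<forall>v. ereal (g \<bullet> v) \<le> clarke_dderiv f x v}"

(* The values of ft at non-positive smoothing parameters play no role. *)
definition smoothing_function ::
    "('a::real_inner \<Rightarrow> real) \<Rightarrow> ('a \<Rightarrow> real \<Rightarrow> real) \<Rightarrow> bool" where
  "smoothing_function f ft \<longleftrightarrow>
     (\<forall>\<mu>>0. (\<forall>x. (\<lambda>z. ft z \<mu>) differentiable (at x)) \<and>
            continuous_on UNIV (gradient (\<lambda>z. ft z \<mu>))) \<and>
     (\<forall>x. ((\<lambda>(z, \<mu>). ft z \<mu>) \<longlongrightarrow> f x) (nhds x \<times>\<^sub>F at_right 0))"

(* M carries the randomness of the method; the samples xi 1, xi 2, ... are independent draws from
   the distribution D of the random vector.  Indices start at 1; the values at 0 are irrelevant. *)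
definition ssg_run ::
    "'w measure \<Rightarrow> (real ^ 'm) measure \<Rightarrow> (real ^ 'n \<Rightarrow> real ^ 'm \<Rightarrow> real \<Rightarrow> real ^ 'n) \<Rightarrow>
     (nat \<Rightarrow> real) \<Rightarrow> (nat \<Rightarrow> real) \<Rightarrow> real ^ 'n \<Rightarrow>
     (nat \<Rightarrow> 'w \<Rightarrow> real ^ 'm) \<Rightarrow> (nat \<Rightarrow> 'w \<Rightarrow> real ^ 'n) \<Rightarrow> bool" where
  "ssg_run M D sg \<alpha> \<mu> x1 \<xi> x \<longleftrightarrow>
     prob_space M \<and>
     prob_space.indep_vars M (\<lambda>_. borel) \<xi> {1..} \<and>
     (\<forall>k\<ge>1. distr M borel (\<xi> k) = D) \<and>
     (\<forall>k\<ge>1. \<alpha> k > 0 \<and> \<mu> k > 0 \<and> \<mu> (Suc k) \<le> \<mu> k) \<and>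
     (\<forall>\<omega>\<in>space M. x 1 \<omega> = x1) \<and>
     (\<forall>k\<ge>1. \<forall>\<omega>\<in>space M. x (Suc k) \<omega> = x k \<omega> - \<alpha> k *\<^sub>R sg (x k \<omega>) (\<xi> k \<omega>) (\<mu> k))"

(* g k is a random vector, so that the expectation of its squared norm is meaningful. *)
definition subgradients_along ::
    "'w measure \<Rightarrow> (real ^ 'n \<Rightarrow> real) \<Rightarrow> (real ^ 'n \<Rightarrow> real \<Rightarrow> real) \<Rightarrow> real \<Rightarrow> real \<Rightarrow>
     (nat \<Rightarrow> real) \<Rightarrow> (nat \<Rightarrow> 'w \<Rightarrow> real ^ 'n) \<Rightarrow> (nat \<Rightarrow> 'w \<Rightarrow> real ^ 'n) \<Rightarrow>
     (nat \<Rightarrow> 'w \<Rightarrow> real ^ 'n) \<Rightarrow> bool" where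
  "subgradients_along M f ft E1 E2 \<mu> x y g \<longleftrightarrow>
     (\<forall>k\<ge>1. g k \<in> borel_measurable M \<and>
       (\<forall>\<omega>\<in>space M.
          y k \<omega> \<in> cball (x k \<omega>) (E1 * \<mu> k) \<and>
          g k \<omega> \<in> clarke_subdifferential f (y k \<omega>) \<and>
          norm (gradient (\<lambda>z. ft z (\<mu> k)) (x k \<omega>) - g k \<omega>) \<le> E2 * \<mu> k))"

definition admissible :: "real \<Rightarrow> real \<Rightarrow> bool" where
  "admissible d b \<longleftrightarrow> d \<in> {1<..7/5} \<and> b \<in> {1/d<..<1}"

definition stepsize :: "real \<Rightarrow> nat \<Rightarrow> real" where
  "stepsize b k = real k powr (- b)"

definition smoothing_param :: "real \<Rightarrow> real \<Rightarrow> nat \<Rightarrow> real" where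
  "smoothing_param d b k = stepsize b k powr (- d / 3 + 2 / 3)"

definition rate :: "real \<Rightarrow> real \<Rightarrow> real" where
  "rate d b = min (1 - b) (2 * b * (2 - d) / 3)"

end

theory Submission
  imports Defs
begin

text \<open>
  The descent lemma for the \<open>C\<^sub>0/\<mu>\<^sub>k\<close>-smooth function \<open>ft(\<cdot>, \<mu>\<^sub>k)\<close> bounds one step of the method by
  \<open>E ft(x\<^sub>k\<^sub>+\<^sub>1, \<mu>\<^sub>k) \<le> E ft(x\<^sub>k, \<mu>\<^sub>k) - \<alpha>\<^sub>k E|h\<^sub>k|^2 + (C\<^sub>0 G^2/2) \<alpha>\<^sub>k^2/\<mu>\<^sub>k^3\<close>, where \<open>h\<^sub>k\<close> is the gradient
  of \<open>ft(\<cdot>, \<mu>\<^sub>k)\<close> at \<open>x\<^sub>k\<close>; the exponent in \<open>\<mu>\<^sub>k\<close> is chosen so that \<open>\<alpha>\<^sub>k^2/\<mu>\<^sub>k^3 = \<alpha>\<^sub>k^d\<close>. Changing \<open>\<mu>\<^sub>k\<close> to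
  \<open>\<mu>\<^sub>k\<^sub>+\<^sub>1\<close> costs \<open>C\<^sub>1(\<mu>\<^sub>k - \<mu>\<^sub>k\<^sub>+\<^sub>1)\<close>, so everything telescopes and \<open>\<Sum>\<alpha>\<^sub>k E|h\<^sub>k|^2\<close> is bounded. Since
  \<open>|g\<^sub>k|^2 \<le> 2|h\<^sub>k|^2 + 2 E\<^sub>2^2 \<mu>\<^sub>k^2\<close> and \<open>\<Sum>\<^sub>k\<^sub>\<le>\<^sub>T \<alpha>\<^sub>k \<ge> T^(1-b)\<close>, averaging with weights \<open>\<alpha>\<^sub>k\<close> gives the rate; the
  \<open>\<epsilon>\<close> absorbs a possible logarithm in \<open>\<Sum>\<alpha>\<^sub>k \<mu>\<^sub>k^2\<close>. The exponent approaches \<open>2/7\<close> for \<open>d = 7/5\<close> and \<open>b \<rightarrow> 5/7\<close>.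
\<close>

section \<open>Gradients and quadratic bounds under a Lipschitz gradient\<close>

text \<open>Riesz representation: the adjoint of the derivative, applied to 1, is a gradient vector,
  and uniqueness of derivatives makes the definite description in \<open>gradient\<close> refer to
  it.\<close>

lemma GDERIV_gradient:
  fixes f :: "'a::euclidean_space \<Rightarrow> real"
  assumes "f differentiable (at x)"
  shows "GDERIV f x :> gradient f x"
proof -
  obtain f' where f': "(f has_derivative f') (at x)"
    using assms by (auto simp: differentiable_def)
  have "f' = (\<lambda>h. h \<bullet> adjoint f' 1)"
    using adjoint_works[OF has_derivative_linear[OF f']] by (simp add: fun_eq_iff)
  with f' have D: "GDERIV f x :> adjoint f' 1"
    by (simp add: gderiv_def)
  have "D' = adjoint f' 1" if "GDERIV f x :> D'" for D'
  proof -
    have "(\<lambda>h. h \<bullet> D') = (\<lambda>h. h \<bullet> adjoint f' 1)"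
      using that D unfolding gderiv_def by (rule has_derivative_unique)
    then show ?thesis
      by (metis vector_eq_ldot)
  qed
  with D show ?thesis
    unfolding gradient_def by (metis theI)
qed

text \<open>Subtracting the linear and quadratic terms along the segment leaves a function
  \<open>\<psi>\<close> of one variable whose derivative is nonpositive by Cauchy-Schwarz and the
  Lipschitz bound. Comparing its values at 0 and 1 avoids integrating the gradient.\<close>

lemma lipschitz_gradient_upper_bound:
  assumes h: "\<And>x. GDERIV \<phi> x :> h x" and L: "L-lipschitz_on UNIV h"
  shows "\<phi> (x + v) \<le> \<phi> x + h x \<bullet> v + L / 2 * (norm v)\<^sup>2"
proof -
  define \<psi> where "\<psi> t = \<phi> (x + t *\<^sub>R v) - t * (h x \<bullet> v) - L * t\<^sup>2 / 2 * (norm v)\<^sup>2" for t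
  have "\<psi> 1 \<le> \<psi> 0"
  proof (rule DERIV_nonpos_imp_nonincreasing[of 0 1])
    fix t :: real assume t: "0 \<le> t" "t \<le> 1"
    have "(\<phi> has_derivative (\<lambda>u. u \<bullet> h (x + t *\<^sub>R v))) (at (x + t *\<^sub>R v))"
      using h[of "x + t *\<^sub>R v"] by (simp add: gderiv_def)
    then have "((\<lambda>t. \<phi> (x + t *\<^sub>R v)) has_derivative (\<lambda>s. (s *\<^sub>R v) \<bullet> h (x + t *\<^sub>R v))) (at t)"
      by (rule has_derivative_compose[rotated]) (auto intro!: derivative_eq_intros)
    then have "((\<lambda>t. \<phi> (x + t *\<^sub>R v)) has_real_derivative h (x + t *\<^sub>R v) \<bullet> v) (at t)"
      by (simp add: has_field_derivative_def inner_commute mult_commute_abs)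
    then have "(\<psi> has_real_derivative (h (x + t *\<^sub>R v) \<bullet> v - h x \<bullet> v - L * t * (norm v)\<^sup>2)) (at t)"
      unfolding \<psi>_def by (auto intro!: derivative_eq_intros)
    moreover have "(h (x + t *\<^sub>R v) - h x) \<bullet> v \<le> L * t * (norm v)\<^sup>2"
    proof -
      have "(h (x + t *\<^sub>R v) - h x) \<bullet> v \<le> norm (h (x + t *\<^sub>R v) - h x) * norm v"
        by (rule norm_cauchy_schwarz)
      also have "norm (h (x + t *\<^sub>R v) - h x) \<le> L * norm (t *\<^sub>R v)"
        using lipschitz_onD[OF L, of "x + t *\<^sub>R v" x] by (simp add: dist_norm)
      finally show ?thesis
        using t by (simp add: mult_right_mono power2_eq_square mult.assoc)
    qed
    ultimately show "\<exists>y. (\<psi> has_real_derivative y) (at t) \<and> y \<le> 0"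
      by (auto simp: inner_diff_left)
  qed simp
  then show ?thesis
    by (simp add: \<psi>_def)
qed

text \<open>Apply the upper bound to \<open>\<phi>\<close> and to its negative. The upper half gives
  descent; the absolute value gives a dominating function, hence integrability at the next
  iterate.\<close>

lemma lipschitz_gradient_approx:
  assumes h: "\<And>x. GDERIV \<phi> x :> h x" and L: "L-lipschitz_on UNIV h"
  shows "\<bar>\<phi> (x + v) - \<phi> x - h x \<bullet> v\<bar> \<le> L / 2 * (norm v)\<^sup>2"
proof -
  have "- \<phi> (x + v) \<le> - \<phi> x + - h x \<bullet> v + L / 2 * (norm v)\<^sup>2"
  proof (rule lipschitz_gradient_upper_bound[where \<phi> = "\<lambda>x. - \<phi> x" and h = "\<lambda>x. - h x"])
    show "GDERIV (\<lambda>x. - \<phi> x) x :> - h x" for x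
      by (rule GDERIV_minus[OF h])
    show "L-lipschitz_on UNIV (\<lambda>x. - h x)"
      using L by simp
  qed
  with lipschitz_gradient_upper_bound[OF h L, of x v] show ?thesis
    unfolding abs_le_iff inner_minus_left by linarith
qed

section \<open>From a bounded weighted sum to a rate for the minimum\<close>

text \<open>A minimum is at most any weighted average. Comparing the error terms with the convergent
  series of k^(-1-\<epsilon>) treats s below, at and above 1 - b uniformly, so the logarithm at
  equality needs no separate case.\<close>

lemma Min_bigo_powr:
  fixes a e :: "nat \<Rightarrow> real"
  assumes b: "0 < b" "b < 1" and "\<epsilon> > 0"
    and e0: "\<And>k. k \<ge> 1 \<Longrightarrow> 0 \<le> e k"
    and e: "\<And>k. k \<ge> 1 \<Longrightarrow> e k \<le> 2 * a k + c * real k powr (- s)"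
    and c: "c \<ge> 0"
    and a: "\<And>T. (\<Sum>k=1..T. real k powr (- b) * a k) \<le> K"
  shows "(\<lambda>T. MIN k\<in>{1..T}. e k) \<in> O(\<lambda>T. real T powr (- min (1 - b) s + \<epsilon>))"
proof -
  define r where "r = min (1 - b) s"
  \<comment> \<open>Since -b - r = -1 + q, this q is the growth exponent left over once k^(-1) is
    split off.\<close>
  define q where "q = 1 - b - r"
  have q: "q \<ge> 0" by (simp add: q_def r_def)
  have summ: "summable (\<lambda>k. real k powr (- 1 - \<epsilon>))"
    using \<open>\<epsilon> > 0\<close> by (simp add: summable_real_powr_iff)
  define Z where "Z = (\<Sum>k. real k powr (- 1 - \<epsilon>))"
  \<comment> \<open>The empty sum at T = 0 forces the bound to be nonnegative.\<close>
  have K: "K \<ge> 0"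
    using a[of 0] by simp
  have "norm (MIN k\<in>{1..T}. e k) \<le> (2 * K + c * Z) * norm (real T powr (- r + \<epsilon>))" if T: "T \<ge> 1" for T
  proof -
    define m where "m = (MIN k\<in>{1..T}. e k)"
    have m: "m \<le> e k" if "k \<in> {1..T}" for k
      unfolding m_def using that by simp
    have m0: "m \<ge> 0"
      unfolding m_def using T e0 by (subst Min_ge_iff) auto
    \<comment> \<open>The factor k^(q+\<epsilon>) grows with k and is replaced by its value at T;
      what remains is summable.\<close>
    have noise: "real k powr (- b) * real k powr (- s) \<le> real k powr (- 1 - \<epsilon>) * real T powr (q + \<epsilon>)"
      if k: "k \<in> {1..T}" for k
    proof -
      have "real k powr (- b) * real k powr (- s) = real k powr (- b - s)"
        using k by (simp flip: powr_add)
      also have "\<dots> \<le> real k powr (- b - r)"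
        using k by (intro powr_mono) (auto simp: r_def)
      also have "\<dots> = real k powr (- 1 - \<epsilon>) * real k powr (q + \<epsilon>)"
        using k by (simp add: q_def algebra_simps flip: powr_add)
      also have "\<dots> \<le> real k powr (- 1 - \<epsilon>) * real T powr (q + \<epsilon>)"
        using k q \<open>\<epsilon> > 0\<close> by (intro mult_left_mono powr_mono2) auto
      finally show ?thesis .
    qed
    \<comment> \<open>T^(1-b) is T copies of T^(-b), the smallest weight among k = 1, ...,
      T.\<close>
    have "real T powr (1 - b) * m = (\<Sum>k=1..T. real T powr (- b) * m)"
      using T by (simp add: powr_diff powr_minus divide_inverse)
    also have "\<dots> \<le> (\<Sum>k=1..T. real k powr (- b) * m)"
      using b m0 by (intro sum_mono mult_right_mono powr_mono2') auto
    also have "\<dots> \<le> (\<Sum>k=1..T. real k powr (- b) * (2 * a k + c * real k powr (- s)))"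
      using m e by (intro sum_mono mult_left_mono) (auto intro: order_trans)
    also have "\<dots> = 2 * (\<Sum>k=1..T. real k powr (- b) * a k)
        + c * (\<Sum>k=1..T. real k powr (- b) * real k powr (- s))"
      by (simp add: sum.distrib sum_distrib_left algebra_simps)
    also have "\<dots> \<le> 2 * K + c * (\<Sum>k=1..T. real k powr (- 1 - \<epsilon>) * real T powr (q + \<epsilon>))"
      using a c noise by (intro add_mono mult_left_mono sum_mono) auto
    also have "\<dots> = 2 * K * 1 + c * (\<Sum>k=1..T. real k powr (- 1 - \<epsilon>)) * real T powr (q + \<epsilon>)"
      by (simp add: sum_distrib_right)
    also have "\<dots> \<le> 2 * K * real T powr (q + \<epsilon>) + c * Z * real T powr (q + \<epsilon>)"
      unfolding Z_def using K c T q \<open>\<epsilon> > 0\<close>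
      by (intro add_mono mult_left_mono mult_right_mono sum_le_suminf[OF summ] ge_one_powr_ge_zero) auto
    also have "\<dots> = (2 * K + c * Z) * (real T powr (- r + \<epsilon>) * real T powr (1 - b))"
      by (simp add: q_def algebra_simps flip: powr_add)
    finally have "real T powr (1 - b) * m \<le> real T powr (1 - b) * ((2 * K + c * Z) * real T powr (- r + \<epsilon>))"
      by (simp add: mult_ac)
    then have "m \<le> (2 * K + c * Z) * real T powr (- r + \<epsilon>)"
      using T by (subst (asm) mult_le_cancel_left_pos) auto
    with m0 show ?thesis
      by (simp add: m_def)
  qed
  \<comment> \<open>Restricting to T at least 1 excludes the minimum over the empty set.\<close>
  then show ?thesis
    unfolding r_def by (intro bigoI eventually_at_top_linorderI) auto
qed

section \<open>One stochastic gradient step in expectation\<close>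

text \<open>Expand the nonnegative variance of Y. It converts a second moment bound on the estimates
  into a pointwise bound on the true gradient.\<close>

lemma (in prob_space) norm_expectation_le:
  fixes Y :: "'a \<Rightarrow> 'b::euclidean_space"
  assumes "integrable M Y" and "integrable M (\<lambda>\<omega>. (norm (Y \<omega>))\<^sup>2)"
  shows "(norm (expectation Y))\<^sup>2 \<le> expectation (\<lambda>\<omega>. (norm (Y \<omega>))\<^sup>2)"
proof -
  let ?m = "expectation Y"
  have eq: "(norm (Y \<omega> - ?m))\<^sup>2 = (norm (Y \<omega>))\<^sup>2 - 2 * (?m \<bullet> Y \<omega>) + (norm ?m)\<^sup>2" for \<omega>
    by (simp add: power2_norm_eq_inner inner_diff inner_commute)
  have "0 \<le> expectation (\<lambda>\<omega>. (norm (Y \<omega> - ?m))\<^sup>2)"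
    by simp
  also have "\<dots> = expectation (\<lambda>\<omega>. (norm (Y \<omega>))\<^sup>2) - (norm ?m)\<^sup>2"
    unfolding eq using assms by (simp add: prob_space power2_norm_eq_inner)
  finally show ?thesis by simp
qed

text \<open>
  Independence is stated through the joint distribution because \<open>indep_var\<close> requires both random
  variables to have the same type.
\<close>
lemma (in prob_space) stochastic_gradient_step:
  fixes X :: "'a \<Rightarrow> 'b::euclidean_space" and S :: "'b \<Rightarrow> 'c::topological_space \<Rightarrow> 'b"
  assumes X[measurable]: "random_variable borel X" and Z[measurable]: "random_variable borel Z"
    and indep: "distr M (borel \<Otimes>\<^sub>M borel) (\<lambda>\<omega>. (X \<omega>, Z \<omega>)) = distr M borel X \<Otimes>\<^sub>M distr M borel Z"
    and D: "distr M borel Z = D"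
    and S: "(\<lambda>(x, s). S x s) \<in> borel_measurable (borel \<Otimes>\<^sub>M borel)"
    and S1: "\<And>x. integrable D (S x)" "\<And>x. integral\<^sup>L D (S x) = h x"
    and S2: "\<And>x. integrable D (\<lambda>s. (norm (S x s))\<^sup>2)" "\<And>x. (\<integral>s. (norm (S x s))\<^sup>2 \<partial>D) \<le> V"
    and h: "\<And>x. GDERIV \<phi> x :> h x" and L: "L-lipschitz_on UNIV h"
    and \<phi>: "integrable M (\<lambda>\<omega>. \<phi> (X \<omega>))" and "\<alpha> \<ge> 0"
  shows "integrable M (\<lambda>\<omega>. (norm (h (X \<omega>)))\<^sup>2)"
    and "integrable M (\<lambda>\<omega>. \<phi> (X \<omega> - \<alpha> *\<^sub>R S (X \<omega>) (Z \<omega>)))"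
    and "expectation (\<lambda>\<omega>. \<phi> (X \<omega> - \<alpha> *\<^sub>R S (X \<omega>) (Z \<omega>)))
      \<le> expectation (\<lambda>\<omega>. \<phi> (X \<omega>)) - \<alpha> * expectation (\<lambda>\<omega>. (norm (h (X \<omega>)))\<^sup>2) + L * V / 2 * \<alpha>\<^sup>2"
proof -
  have S_meas[measurable]: "(\<lambda>p. S (fst p) (snd p)) \<in> borel_measurable (borel \<Otimes>\<^sub>M borel)"
    using S by (simp add: case_prod_beta')
  define P where "P = distr M borel X"
  interpret P: prob_space P
    unfolding P_def by (rule prob_space_distr) simp
  interpret D: prob_space D
    unfolding D[symmetric] by (rule prob_space_distr) simp
  interpret PD: pair_prob_space P D ..
  have sets_D[measurable_cong]: "sets D = sets borel" and sets_P[measurable_cong]: "sets P = sets borel"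
    by (auto simp: P_def simp flip: D)
  have joint: "P \<Otimes>\<^sub>M D = distr M (borel \<Otimes>\<^sub>M borel) (\<lambda>\<omega>. (X \<omega>, Z \<omega>))"
    using indep by (simp add: P_def D)
  have XZ[measurable]: "(\<lambda>\<omega>. (X \<omega>, Z \<omega>)) \<in> M \<rightarrow>\<^sub>M borel \<Otimes>\<^sub>M borel"
    by measurable
  have SXZ[measurable]: "(\<lambda>\<omega>. S (X \<omega>) (Z \<omega>)) \<in> borel_measurable M"
    using measurable_compose[OF XZ S_meas] by simp
  have h_meas[measurable]: "h \<in> borel_measurable borel"
    using lipschitz_on_continuous_on[OF L] by (rule borel_measurable_continuous_onI)
  have "continuous_on UNIV \<phi>"
    using h unfolding gderiv_def
    by (auto intro!: continuous_at_imp_continuous_on has_derivative_continuous)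
  then have \<phi>_meas[measurable]: "\<phi> \<in> borel_measurable borel"
    by (rule borel_measurable_continuous_onI)
  have V: "V \<ge> 0"
    using order_trans[OF _ S2(2)] by (auto intro!: integral_nonneg)
  \<comment> \<open>The gradient is uniformly bounded, so integrability of its squared norm requires
    no moments of X.\<close>
  have h_bound: "(norm (h x))\<^sup>2 \<le> V" for x
    using D.norm_expectation_le[OF S1(1) S2(1), of x] S2(2)[of x] S1(2)[of x] by simp

  have int_h: "integrable M (\<lambda>\<omega>. (norm (h (X \<omega>)))\<^sup>2)"
    by (rule integrable_const_bound[where B = V]) (auto simp: h_bound)
  \<comment> \<open>Integrability over the joint law is not yet known, so Tonelli is applied to the
    nonnegative integral; its finiteness then yields integrability.\<close>
  have nn: "(\<integral>\<^sup>+\<omega>. ennreal ((norm (S (X \<omega>) (Z \<omega>)))\<^sup>2) \<partial>M) \<le> ennreal V"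
  proof -
    have "(\<integral>\<^sup>+\<omega>. ennreal ((norm (S (X \<omega>) (Z \<omega>)))\<^sup>2) \<partial>M)
        = (\<integral>\<^sup>+p. ennreal ((norm (S (fst p) (snd p)))\<^sup>2) \<partial>(P \<Otimes>\<^sub>M D))"
      unfolding joint by (subst nn_integral_distr) auto
    also have "\<dots> = (\<integral>\<^sup>+x. (\<integral>\<^sup>+s. ennreal ((norm (S x s))\<^sup>2) \<partial>D) \<partial>P)"
      by (subst D.nn_integral_fst[symmetric]) auto
    also have "\<dots> = (\<integral>\<^sup>+x. ennreal (\<integral>s. (norm (S x s))\<^sup>2 \<partial>D) \<partial>P)"
      using S2(1) by (simp add: nn_integral_eq_integral)
    also have "\<dots> \<le> (\<integral>\<^sup>+x. ennreal V \<partial>P)"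
      using S2(2) by (intro nn_integral_mono ennreal_leI)
    finally show ?thesis
      by (simp add: P.emeasure_space_1)
  qed
  have int_S: "integrable M (\<lambda>\<omega>. (norm (S (X \<omega>) (Z \<omega>)))\<^sup>2)"
    by (rule integrableI_nonneg[OF _ _ le_less_trans[OF nn]]) simp_all
  have ES: "expectation (\<lambda>\<omega>. (norm (S (X \<omega>) (Z \<omega>)))\<^sup>2) \<le> V"
    using nn V unfolding nn_integral_eq_integral[OF int_S AE_I2, simplified] by simp

  have int_hS: "integrable M (\<lambda>\<omega>. h (X \<omega>) \<bullet> S (X \<omega>) (Z \<omega>))"
  proof (rule Bochner_Integration.integrable_bound)
    show "integrable M (\<lambda>\<omega>. (norm (h (X \<omega>)))\<^sup>2 + (norm (S (X \<omega>) (Z \<omega>)))\<^sup>2)"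
      using int_h int_S by (rule Bochner_Integration.integrable_add)
    have "\<bar>u \<bullet> v\<bar> \<le> (norm u)\<^sup>2 + (norm v)\<^sup>2" for u v :: 'b
      using Cauchy_Schwarz_ineq2[of u v] sum_squares_bound[of "norm u" "norm v"]
        zero_le_power2[of "norm u"] zero_le_power2[of "norm v"]
      by linarith
    then show "AE \<omega> in M. norm (h (X \<omega>) \<bullet> S (X \<omega>) (Z \<omega>))
        \<le> norm ((norm (h (X \<omega>)))\<^sup>2 + (norm (S (X \<omega>) (Z \<omega>)))\<^sup>2)"
      by simp
  qed simp
  \<comment> \<open>By independence the sample can be integrated first at a fixed point x, where
    unbiasedness replaces the estimate by h x.\<close>
  have E_hS: "expectation (\<lambda>\<omega>. h (X \<omega>) \<bullet> S (X \<omega>) (Z \<omega>)) = expectation (\<lambda>\<omega>. (norm (h (X \<omega>)))\<^sup>2)"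
  proof -
    let ?F = "\<lambda>p. h (fst p) \<bullet> S (fst p) (snd p)"
    have "integrable (P \<Otimes>\<^sub>M D) ?F"
      unfolding joint by (subst integrable_distr_eq) (use int_hS in auto)
    note fub = PD.integral_fst'[OF this]
    have "expectation (\<lambda>\<omega>. h (X \<omega>) \<bullet> S (X \<omega>) (Z \<omega>)) = integral\<^sup>L (P \<Otimes>\<^sub>M D) ?F"
      unfolding joint by (subst integral_distr) auto
    also have "\<dots> = (\<integral>x. (norm (h x))\<^sup>2 \<partial>P)"
      unfolding fub[symmetric] using S1 by (simp add: power2_norm_eq_inner)
    also have "\<dots> = expectation (\<lambda>\<omega>. (norm (h (X \<omega>)))\<^sup>2)"
      unfolding P_def by (subst integral_distr) auto
    finally show ?thesis .
  qed

  let ?Y = "\<lambda>\<omega>. X \<omega> - \<alpha> *\<^sub>R S (X \<omega>) (Z \<omega>)"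
  let ?R = "\<lambda>\<omega>. L / 2 * \<alpha>\<^sup>2 * (norm (S (X \<omega>) (Z \<omega>)))\<^sup>2"
  have descent: "\<bar>\<phi> (?Y \<omega>) - \<phi> (X \<omega>) + \<alpha> * (h (X \<omega>) \<bullet> S (X \<omega>) (Z \<omega>))\<bar> \<le> ?R \<omega>" for \<omega>
    using lipschitz_gradient_approx[OF h L, of "X \<omega>" "- \<alpha> *\<^sub>R S (X \<omega>) (Z \<omega>)"]
    by (simp add: power_mult_distrib mult_ac)
  have int_R: "integrable M ?R"
    using int_S by simp
  \<comment> \<open>Only the remainder of the linear expansion is dominated directly. Adding back
    the value at X and subtracting the inner product term, both integrable, leaves \<phi> at the
    next iterate.\<close>
  have "integrable M (\<lambda>\<omega>. \<phi> (?Y \<omega>) - \<phi> (X \<omega>) + \<alpha> * (h (X \<omega>) \<bullet> S (X \<omega>) (Z \<omega>)))"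
    by (rule Bochner_Integration.integrable_bound[OF int_R])
       (use descent in \<open>auto intro: order_trans[OF _ abs_ge_self]\<close>)
  from Bochner_Integration.integrable_diff[OF Bochner_Integration.integrable_add[OF this \<phi>]
      integrable_mult_right[OF int_hS, of \<alpha>]]
  have int_Y: "integrable M (\<lambda>\<omega>. \<phi> (?Y \<omega>))"
    by simp
  have "expectation (\<lambda>\<omega>. \<phi> (?Y \<omega>))
      \<le> expectation (\<lambda>\<omega>. \<phi> (X \<omega>) - \<alpha> * (h (X \<omega>) \<bullet> S (X \<omega>) (Z \<omega>)) + ?R \<omega>)"
  proof (rule integral_mono[OF int_Y])
    show "integrable M (\<lambda>\<omega>. \<phi> (X \<omega>) - \<alpha> * (h (X \<omega>) \<bullet> S (X \<omega>) (Z \<omega>)) + ?R \<omega>)"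
      using \<phi> int_hS int_S by (intro Bochner_Integration.integrable_add
          Bochner_Integration.integrable_diff integrable_mult_right)
    show "\<phi> (?Y \<omega>) \<le> \<phi> (X \<omega>) - \<alpha> * (h (X \<omega>) \<bullet> S (X \<omega>) (Z \<omega>)) + ?R \<omega>" for \<omega>
      using descent[of \<omega>] by linarith
  qed
  also have "\<dots> = expectation (\<lambda>\<omega>. \<phi> (X \<omega>)) - \<alpha> * expectation (\<lambda>\<omega>. (norm (h (X \<omega>)))\<^sup>2)
      + L / 2 * \<alpha>\<^sup>2 * expectation (\<lambda>\<omega>. (norm (S (X \<omega>) (Z \<omega>)))\<^sup>2)"
    using \<phi> int_hS int_S by (simp flip: E_hS)
  also have "\<dots> \<le> expectation (\<lambda>\<omega>. \<phi> (X \<omega>)) - \<alpha> * expectation (\<lambda>\<omega>. (norm (h (X \<omega>)))\<^sup>2)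
      + L / 2 * \<alpha>\<^sup>2 * V"
    using ES lipschitz_on_nonneg[OF L] by (intro add_left_mono mult_left_mono) auto
  finally show "expectation (\<lambda>\<omega>. \<phi> (?Y \<omega>)) \<le> expectation (\<lambda>\<omega>. \<phi> (X \<omega>))
      - \<alpha> * expectation (\<lambda>\<omega>. (norm (h (X \<omega>)))\<^sup>2) + L * V / 2 * \<alpha>\<^sup>2"
    by (simp add: mult_ac)
  show "integrable M (\<lambda>\<omega>. (norm (h (X \<omega>)))\<^sup>2)" "integrable M (\<lambda>\<omega>. \<phi> (?Y \<omega>))"
    by fact+
qed

section \<open>Independence of the current iterate and the current sample\<close>

text \<open>Writing the run as a function of the sample sequence exposes its dependence on the past
  only. Indices are shifted: stage k is the point x (Suc k) of the method and reads the samples s 1,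
  ..., s k.\<close>

fun iterate :: "('b::real_vector \<Rightarrow> 'c \<Rightarrow> real \<Rightarrow> 'b) \<Rightarrow> (nat \<Rightarrow> real) \<Rightarrow> (nat \<Rightarrow> real) \<Rightarrow> 'b \<Rightarrow>
    nat \<Rightarrow> (nat \<Rightarrow> 'c) \<Rightarrow> 'b" where
  "iterate sg \<alpha> \<mu> x1 0 s = x1"
| "iterate sg \<alpha> \<mu> x1 (Suc k) s = (let x = iterate sg \<alpha> \<mu> x1 k s in x - \<alpha> (Suc k) *\<^sub>R sg x (s (Suc k)) (\<mu> (Suc k)))"

lemma iterate_cong:
  "(\<And>i. i \<in> {1..k} \<Longrightarrow> s i = s' i) \<Longrightarrow> iterate sg \<alpha> \<mu> x1 k s = iterate sg \<alpha> \<mu> x1 k s'"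
  by (induction k) (auto simp: Let_def)

text \<open>The product space is indexed up to a fixed n, so the induction on k stays on one
  space.\<close>

lemma measurable_iterate:
  fixes sg :: "'b::euclidean_space \<Rightarrow> 'c::topological_space \<Rightarrow> real \<Rightarrow> 'b"
  assumes sg: "\<And>k. k \<ge> 1 \<Longrightarrow> (\<lambda>(x, s). sg x s (\<mu> k)) \<in> borel_measurable (borel \<Otimes>\<^sub>M borel)"
    and "k \<le> n"
  shows "iterate sg \<alpha> \<mu> x1 k \<in> borel_measurable (Pi\<^sub>M {1..n} (\<lambda>_. borel))"
  using \<open>k \<le> n\<close>
proof (induction k)
  case (Suc k)
  have I[measurable]: "iterate sg \<alpha> \<mu> x1 k \<in> borel_measurable (Pi\<^sub>M {1..n} (\<lambda>_. borel))"
    by (rule Suc.IH[OF Suc_leD[OF Suc.prems]])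
  have "(\<lambda>s. (iterate sg \<alpha> \<mu> x1 k s, s (Suc k))) \<in> Pi\<^sub>M {1..n} (\<lambda>_. borel) \<rightarrow>\<^sub>M borel \<Otimes>\<^sub>M borel"
    using Suc.prems by (intro measurable_Pair[OF I] measurable_component_singleton) auto
  from measurable_compose[OF this sg[of "Suc k"]]
  have [measurable]: "(\<lambda>s. sg (iterate sg \<alpha> \<mu> x1 k s) (s (Suc k)) (\<mu> (Suc k)))
      \<in> borel_measurable (Pi\<^sub>M {1..n} (\<lambda>_. borel))"
    by simp
  have "(\<lambda>s. iterate sg \<alpha> \<mu> x1 (Suc k) s) \<in> borel_measurable (Pi\<^sub>M {1..n} (\<lambda>_. borel))"
    unfolding iterate.simps Let_def by measurable
  then show ?case .
next
  case 0
  have "(\<lambda>s. iterate sg \<alpha> \<mu> x1 0 s) \<in> borel_measurable (Pi\<^sub>M {1..n} (\<lambda>_. borel))"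
    by simp
  then show ?case .
qed

text \<open>The point x k is a measurable function of the first k - 1 samples, and disjoint blocks
  of an independent family are independent. The current sample is taken as the block indexed by
  {k}.\<close>

lemma ssg_run_indep:
  fixes sg :: "real ^ 'n \<Rightarrow> real ^ 'm \<Rightarrow> real \<Rightarrow> real ^ 'n"
  assumes run: "ssg_run M D sg \<alpha> \<mu> x1 \<xi> x"
    and sg: "\<And>\<mu>. \<mu> > 0 \<Longrightarrow> (\<lambda>(x, s). sg x s \<mu>) \<in> borel_measurable (borel \<Otimes>\<^sub>M borel)"
    and "k \<ge> 1"
  shows "x k \<in> borel_measurable M"
    and "distr M (borel \<Otimes>\<^sub>M borel) (\<lambda>\<omega>. (x k \<omega>, \<xi> k \<omega>)) = distr M borel (x k) \<Otimes>\<^sub>M distr M borel (\<xi> k)"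
proof -
  interpret prob_space M
    using run by (simp add: ssg_run_def)
  have \<xi>: "indep_vars (\<lambda>_. borel) \<xi> {1..}" and \<mu>: "\<And>k. k \<ge> 1 \<Longrightarrow> \<mu> k > 0"
    and x1: "\<And>\<omega>. \<omega> \<in> space M \<Longrightarrow> x 1 \<omega> = x1"
    and step: "\<And>k \<omega>. k \<ge> 1 \<Longrightarrow> \<omega> \<in> space M \<Longrightarrow> x (Suc k) \<omega> = x k \<omega> - \<alpha> k *\<^sub>R sg (x k \<omega>) (\<xi> k \<omega>) (\<mu> k)"
    using run by (auto simp: ssg_run_def)
  obtain j where k: "k = Suc j"
    using \<open>k \<ge> 1\<close> by (cases k) auto
  let ?I = "iterate sg \<alpha> \<mu> x1 j"
  let ?A = "\<lambda>\<omega>. restrict (\<lambda>i. \<xi> i \<omega>) {1..j}" and ?B = "\<lambda>\<omega>. restrict (\<lambda>i. \<xi> i \<omega>) {k}"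
  let ?MA = "Pi\<^sub>M {1..j} (\<lambda>_. borel :: (real ^ 'm) measure)" and ?MB = "Pi\<^sub>M {k} (\<lambda>_. borel :: (real ^ 'm) measure)"
  have x_eq: "x (Suc j) \<omega> = iterate sg \<alpha> \<mu> x1 j (\<lambda>i. \<xi> i \<omega>)" if "\<omega> \<in> space M" for j \<omega>
    using that by (induction j) (auto simp: x1[simplified] step Let_def)
  have x_k: "?I (?A \<omega>) = x k \<omega>" if "\<omega> \<in> space M" for \<omega>
    unfolding k x_eq[OF that] by (rule iterate_cong) auto
  have "indep_var ?MA ?A ?MB ?B"
    by (rule indep_var_restrict[OF \<xi>]) (auto simp: k)
  then have A[measurable]: "?A \<in> M \<rightarrow>\<^sub>M ?MA" and B[measurable]: "?B \<in> M \<rightarrow>\<^sub>M ?MB"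
    and AB: "distr M ?MA ?A \<Otimes>\<^sub>M distr M ?MB ?B = distr M (?MA \<Otimes>\<^sub>M ?MB) (\<lambda>\<omega>. (?A \<omega>, ?B \<omega>))"
    unfolding indep_var_distribution_eq by auto
  have I[measurable]: "?I \<in> ?MA \<rightarrow>\<^sub>M borel"
    using sg \<mu> by (intro measurable_iterate) auto
  have ev[measurable]: "(\<lambda>s. s k) \<in> ?MB \<rightarrow>\<^sub>M borel"
    by (rule measurable_component_singleton) simp
  have "(\<lambda>\<omega>. ?I (?A \<omega>)) \<in> borel_measurable M"
    by (rule measurable_compose[OF A I])
  then show "x k \<in> borel_measurable M"
    by (subst measurable_cong[OF x_k[symmetric]])
  have dx: "distr (distr M ?MA ?A) borel ?I = distr M borel (x k)"
    unfolding distr_distr[OF I A] by (rule distr_cong) (simp_all only: o_apply x_k)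
  have d\<xi>: "distr (distr M ?MB ?B) borel (\<lambda>s. s k) = distr M borel (\<xi> k)"
    unfolding distr_distr[OF ev B] by (rule distr_cong) simp_all
  have "\<xi> k \<in> borel_measurable M"
    using measurable_compose[OF B ev] by simp
  then interpret \<xi>k: prob_space "distr M borel (\<xi> k)"
    by (rule prob_space_distr)
  have IE: "(\<lambda>(s, t). (?I s, t k)) \<in> ?MA \<Otimes>\<^sub>M ?MB \<rightarrow>\<^sub>M borel \<Otimes>\<^sub>M borel"
    unfolding case_prod_beta'
    by (intro measurable_Pair measurable_compose[OF measurable_fst I] measurable_compose[OF measurable_snd ev])
  \<comment> \<open>The product law of the two blocks is pushed forward through the iterate map on
    the past and evaluation at k on the present.\<close>
  have "distr M borel (x k) \<Otimes>\<^sub>M distr M borel (\<xi> k)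
      = distr (distr M ?MA ?A \<Otimes>\<^sub>M distr M ?MB ?B) (borel \<Otimes>\<^sub>M borel) (\<lambda>(s, t). (?I s, t k))"
    unfolding dx[symmetric] d\<xi>[symmetric]
    by (rule pair_measure_distr)
       (simp_all only: measurable_distr_eq1 I ev d\<xi> \<xi>k.sigma_finite_measure_axioms)
  also have "\<dots> = distr M (borel \<Otimes>\<^sub>M borel) (\<lambda>\<omega>. (x k \<omega>, \<xi> k \<omega>))"
    unfolding AB distr_distr[OF IE measurable_Pair[OF A B]] by (rule distr_cong) (simp_all add: x_k[simplified])
  finally show "distr M (borel \<Otimes>\<^sub>M borel) (\<lambda>\<omega>. (x k \<omega>, \<xi> k \<omega>)) = distr M borel (x k) \<Otimes>\<^sub>M distr M borel (\<xi> k)"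
    by simp
qed

section \<open>Expected descent along the run\<close>

text \<open>Together with \<open>approx\<close>, the lower bound \<open>m\<close> of f keeps the
  expected smoothed values bounded below, which closes the telescoping sum.\<close>

locale smoothed_stochastic_gradient =
  fixes f :: "real ^ 'n \<Rightarrow> real" and ft :: "real ^ 'n \<Rightarrow> real \<Rightarrow> real"
    and sg :: "real ^ 'n \<Rightarrow> real ^ 'm \<Rightarrow> real \<Rightarrow> real ^ 'n" and D :: "(real ^ 'm) measure"
    and G C C0 C1 m :: real
  assumes bounded_below: "\<And>x. m \<le> f x"
    and differentiable_ft: "\<And>x \<mu>. \<mu> > 0 \<Longrightarrow> (\<lambda>z. ft z \<mu>) differentiable (at x)"
    and measurable_sg: "\<And>\<mu>. \<mu> > 0 \<Longrightarrow> (\<lambda>(x, s). sg x s \<mu>) \<in> borel_measurable (borel \<Otimes>\<^sub>M borel)"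
    and integrable_sg: "\<And>x \<mu>. \<mu> > 0 \<Longrightarrow> integrable D (\<lambda>s. sg x s \<mu>)"
    and unbiased: "\<And>x \<mu>. \<mu> > 0 \<Longrightarrow> (\<integral>s. sg x s \<mu> \<partial>D) = gradient (\<lambda>z. ft z \<mu>) x"
    and integrable_sg_sq: "\<And>x \<mu>. \<mu> > 0 \<Longrightarrow> integrable D (\<lambda>s. (norm (sg x s \<mu>))\<^sup>2)"
    and second_moment: "\<And>x \<mu>. \<mu> > 0 \<Longrightarrow> (\<integral>s. (norm (sg x s \<mu>))\<^sup>2 \<partial>D) \<le> G\<^sup>2 / \<mu>\<^sup>2"
    and C_nonneg: "C \<ge> 0" and approx: "\<And>x \<mu>. \<mu> > 0 \<Longrightarrow> \<bar>f x - ft x \<mu>\<bar> \<le> C * \<mu>"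
    and C0_nonneg: "C0 \<ge> 0"
    and lipschitz_gradient: "\<And>\<mu>. \<mu> > 0 \<Longrightarrow> (C0 / \<mu>)-lipschitz_on UNIV (gradient (\<lambda>z. ft z \<mu>))"
    and C1_nonneg: "C1 \<ge> 0"
    and lipschitz_param: "\<And>x \<mu> \<mu>'. \<mu> > 0 \<Longrightarrow> \<mu>' > 0 \<Longrightarrow> \<bar>ft x \<mu>' - ft x \<mu>\<bar> \<le> C1 * \<bar>\<mu>' - \<mu>\<bar>"
begin

text \<open>The step splits into a move of the point at fixed \<mu> k and a change of the parameter
  at fixed point. Integrability is assumed at k and concluded at Suc k so that it propagates along
  the run.\<close>

lemma ssg_step:
  assumes run: "ssg_run M D sg \<alpha> \<mu> x1 \<xi> x" and k: "k \<ge> 1"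
    and int: "integrable M (\<lambda>\<omega>. ft (x k \<omega>) (\<mu> k))"
  shows "integrable M (\<lambda>\<omega>. (norm (gradient (\<lambda>z. ft z (\<mu> k)) (x k \<omega>)))\<^sup>2)"
    and "integrable M (\<lambda>\<omega>. ft (x (Suc k) \<omega>) (\<mu> (Suc k)))"
    and "(\<integral>\<omega>. ft (x (Suc k) \<omega>) (\<mu> (Suc k)) \<partial>M) \<le> (\<integral>\<omega>. ft (x k \<omega>) (\<mu> k) \<partial>M)
      - \<alpha> k * (\<integral>\<omega>. (norm (gradient (\<lambda>z. ft z (\<mu> k)) (x k \<omega>)))\<^sup>2 \<partial>M)
      + C0 * G\<^sup>2 / 2 * ((\<alpha> k)\<^sup>2 / \<mu> k ^ 3) + C1 * (\<mu> k - \<mu> (Suc k))"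
proof -
  interpret prob_space M
    using run by (simp add: ssg_run_def)
  have pos: "\<mu> k > 0" "\<mu> (Suc k) > 0" "\<alpha> k \<ge> 0" and mono: "\<mu> (Suc k) \<le> \<mu> k"
    using run k by (auto simp: ssg_run_def less_imp_le)
  have D: "distr M borel (\<xi> k) = D"
    using run k by (simp add: ssg_run_def)
  have next_eq: "x (Suc k) \<omega> = x k \<omega> - \<alpha> k *\<^sub>R sg (x k \<omega>) (\<xi> k \<omega>) (\<mu> k)" if "\<omega> \<in> space M" for \<omega>
    using run k that by (simp add: ssg_run_def)
  have \<xi>: "random_variable borel (\<xi> k)"
    using run k by (auto simp: ssg_run_def indep_vars_def)
  \<comment> \<open>The product L V = C0 G^2 / \<mu>^3 is the source of the cube in the error
    term.\<close>
  note step = stochastic_gradient_step[where X = "x k" and Z = "\<xi> k" and S = "\<lambda>x s. sg x s (\<mu> k)"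
      and \<phi> = "\<lambda>z. ft z (\<mu> k)" and h = "gradient (\<lambda>z. ft z (\<mu> k))" and D = D and V = "G\<^sup>2 / (\<mu> k)\<^sup>2"
      and L = "C0 / \<mu> k" and \<alpha> = "\<alpha> k",
      OF ssg_run_indep(1)[OF run measurable_sg k] \<xi> ssg_run_indep(2)[OF run measurable_sg k] D
        measurable_sg[OF pos(1)] integrable_sg[OF pos(1)] unbiased[OF pos(1)] integrable_sg_sq[OF pos(1)]
        second_moment[OF pos(1)] GDERIV_gradient[OF differentiable_ft[OF pos(1)]]
        lipschitz_gradient[OF pos(1)] int pos(3)]
  show "integrable M (\<lambda>\<omega>. (norm (gradient (\<lambda>z. ft z (\<mu> k)) (x k \<omega>)))\<^sup>2)"
    by (rule step(1)) assumption
  have int_next: "integrable M (\<lambda>\<omega>. ft (x (Suc k) \<omega>) (\<mu> k))"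
    using step(2) by (simp add: next_eq cong: Bochner_Integration.integrable_cong)
  have E_next: "expectation (\<lambda>\<omega>. ft (x (Suc k) \<omega>) (\<mu> k)) \<le> expectation (\<lambda>\<omega>. ft (x k \<omega>) (\<mu> k))
      - \<alpha> k * expectation (\<lambda>\<omega>. (norm (gradient (\<lambda>z. ft z (\<mu> k)) (x k \<omega>)))\<^sup>2)
      + C0 / \<mu> k * (G\<^sup>2 / (\<mu> k)\<^sup>2) / 2 * (\<alpha> k)\<^sup>2"
    using step(3) by (simp add: next_eq cong: Bochner_Integration.integral_cong)
  \<comment> \<open>Monotonicity of the parameters removes the absolute value, so that these costs
    telescope.\<close>
  have change: "\<bar>ft z (\<mu> (Suc k)) - ft z (\<mu> k)\<bar> \<le> C1 * (\<mu> k - \<mu> (Suc k))" for z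
    using lipschitz_param[OF pos(1) pos(2), of z] mono by simp
  have [measurable]: "x (Suc k) \<in> borel_measurable M"
    by (rule ssg_run_indep(1)[OF run measurable_sg]) auto
  have "continuous_on UNIV (\<lambda>z. ft z (\<mu> (Suc k)))"
    using differentiable_ft[OF pos(2)]
    by (auto intro!: continuous_at_imp_continuous_on differentiable_imp_continuous_within)
  then have [measurable]: "(\<lambda>z. ft z (\<mu> (Suc k))) \<in> borel_measurable borel"
    by (rule borel_measurable_continuous_onI)
  have meas: "(\<lambda>\<omega>. ft (x (Suc k) \<omega>) (\<mu> (Suc k))) \<in> borel_measurable M"
    by measurable
  have "integrable M (\<lambda>\<omega>. ft (x (Suc k) \<omega>) (\<mu> (Suc k)) - ft (x (Suc k) \<omega>) (\<mu> k))"
    using change meas int_next by (intro integrable_const_bound[where B = "C1 * (\<mu> k - \<mu> (Suc k))"]) auto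
  from Bochner_Integration.integrable_add[OF this int_next]
  show int': "integrable M (\<lambda>\<omega>. ft (x (Suc k) \<omega>) (\<mu> (Suc k)))"
    by simp
  have "expectation (\<lambda>\<omega>. ft (x (Suc k) \<omega>) (\<mu> (Suc k)))
      \<le> expectation (\<lambda>\<omega>. ft (x (Suc k) \<omega>) (\<mu> k) + C1 * (\<mu> k - \<mu> (Suc k)))"
  proof (rule integral_mono[OF int'])
    show "integrable M (\<lambda>\<omega>. ft (x (Suc k) \<omega>) (\<mu> k) + C1 * (\<mu> k - \<mu> (Suc k)))"
      using int_next by simp
    show "ft (x (Suc k) \<omega>) (\<mu> (Suc k)) \<le> ft (x (Suc k) \<omega>) (\<mu> k) + C1 * (\<mu> k - \<mu> (Suc k))" for \<omega>
      using change[of "x (Suc k) \<omega>"] by linarith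
  qed
  also have "\<dots> = expectation (\<lambda>\<omega>. ft (x (Suc k) \<omega>) (\<mu> k)) + C1 * (\<mu> k - \<mu> (Suc k))"
    using int_next by (simp add: prob_space)
  also note E_next
  also have "C0 / \<mu> k * (G\<^sup>2 / (\<mu> k)\<^sup>2) / 2 * (\<alpha> k)\<^sup>2 = C0 * G\<^sup>2 / 2 * ((\<alpha> k)\<^sup>2 / \<mu> k ^ 3)"
    by (simp add: power2_eq_square power3_eq_cube)
  finally show "expectation (\<lambda>\<omega>. ft (x (Suc k) \<omega>) (\<mu> (Suc k))) \<le> expectation (\<lambda>\<omega>. ft (x k \<omega>) (\<mu> k))
      - \<alpha> k * expectation (\<lambda>\<omega>. (norm (gradient (\<lambda>z. ft z (\<mu> k)) (x k \<omega>)))\<^sup>2)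
      + C0 * G\<^sup>2 / 2 * ((\<alpha> k)\<^sup>2 / \<mu> k ^ 3) + C1 * (\<mu> k - \<mu> (Suc k))"
    by simp
qed

lemma ssg_integrable:
  assumes run: "ssg_run M D sg \<alpha> \<mu> x1 \<xi> x" and "k \<ge> 1"
  shows "integrable M (\<lambda>\<omega>. ft (x k \<omega>) (\<mu> k))"
  using \<open>k \<ge> 1\<close>
proof (induction k rule: dec_induct)
  case base
  interpret prob_space M
    using run by (simp add: ssg_run_def)
  have "\<omega> \<in> space M \<Longrightarrow> ft (x 1 \<omega>) (\<mu> 1) = ft x1 (\<mu> 1)" for \<omega>
    using run by (simp add: ssg_run_def)
  then show ?case
    by (subst Bochner_Integration.integrable_cong[OF refl, where g = "\<lambda>_. ft x1 (\<mu> 1)"]) auto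
next
  case (step k)
  then show ?case
    using ssg_step(2)[OF run] by simp
qed

text \<open>The expectation of \<open>ft (x k) (\<mu> k)\<close> plus C1 \<mu> k acts as a Lyapunov
  function: up to the summed noise, each step lowers it by the weighted squared gradient. Its
  initial value contributes C1 \<mu> 1, its lower bound C \<mu> 1.\<close>

lemma ssg_weighted_gradient_sum:
  assumes run: "ssg_run M D sg \<alpha> \<mu> x1 \<xi> x"
  shows "(\<Sum>k=1..T. \<alpha> k * (\<integral>\<omega>. (norm (gradient (\<lambda>z. ft z (\<mu> k)) (x k \<omega>)))\<^sup>2 \<partial>M))
    \<le> ft x1 (\<mu> 1) - m + (C + C1) * \<mu> 1 + C0 * G\<^sup>2 / 2 * (\<Sum>k=1..T. (\<alpha> k)\<^sup>2 / \<mu> k ^ 3)"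
proof -
  interpret prob_space M
    using run by (simp add: ssg_run_def)
  define F where "F k = expectation (\<lambda>\<omega>. ft (x k \<omega>) (\<mu> k))" for k
  have pos: "\<mu> k > 0" and mono: "\<mu> (Suc k) \<le> \<mu> k" if "k \<ge> 1" for k
    using run that by (auto simp: ssg_run_def)
  have "expectation (\<lambda>\<omega>. ft (x 1 \<omega>) (\<mu> 1)) = expectation (\<lambda>_. ft x1 (\<mu> 1))"
    using run by (intro Bochner_Integration.integral_cong) (auto simp: ssg_run_def)
  then have F1: "F 1 = ft x1 (\<mu> 1)"
    by (simp add: F_def prob_space)
  have telescope: "(\<Sum>k=1..T. \<alpha> k * expectation (\<lambda>\<omega>. (norm (gradient (\<lambda>z. ft z (\<mu> k)) (x k \<omega>)))\<^sup>2))
      + F (Suc T) + C1 * \<mu> (Suc T)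
      \<le> F 1 + C1 * \<mu> 1 + C0 * G\<^sup>2 / 2 * (\<Sum>k=1..T. (\<alpha> k)\<^sup>2 / \<mu> k ^ 3)"
  proof (induction T)
    case (Suc T)
    have "Suc T \<ge> 1" by simp
    from ssg_step(3)[OF run this ssg_integrable[OF run this]] Suc.IH
    show ?case
      by (simp add: F_def algebra_simps)
  qed simp
  have \<mu>_le: "\<mu> (Suc T) \<le> \<mu> 1"
    by (induction T) (use mono in \<open>auto intro: order_trans\<close>)
  have "m - C * \<mu> (Suc T) \<le> ft z (\<mu> (Suc T))" for z
    using approx[OF pos[of "Suc T"], of z] bounded_below[of z] by simp
  then have "m - C * \<mu> (Suc T) \<le> F (Suc T)"
    unfolding F_def by (intro integral_ge_const ssg_integrable[OF run] AE_I2) auto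
  moreover have "C * \<mu> (Suc T) \<le> C * \<mu> 1" "0 \<le> C1 * \<mu> (Suc T)"
    using \<mu>_le C_nonneg C1_nonneg pos[of "Suc T"] by (auto intro: mult_left_mono)
  ultimately show ?thesis
    using telescope F1 by (simp add: algebra_simps)
qed

end

section \<open>Exponents of the stepsizes and smoothing parameters\<close>

lemma admissibleD:
  assumes "admissible d b"
  shows "1 < d" "d \<le> 7 / 5" "0 < b" "b < 1" "1 < b * d"
proof -
  show d: "1 < d" "d \<le> 7 / 5" and "b < 1"
    using assms by (simp_all add: admissible_def)
  have "1 / d < b"
    using assms by (simp add: admissible_def)
  then show "1 < b * d"
    using d by (simp add: pos_divide_less_eq)
  show "0 < b"
    using d by (intro less_trans[OF _ \<open>1 / d < b\<close>]) simp
qed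

text \<open>The exponent p = (2 - d)/3 solves 2 - 3p = d, so the noise terms form exactly the series
  that converges when b d > 1.\<close>

lemma stepsize_sq_div_smoothing_param_cube:
  assumes "k \<ge> 1"
  shows "(stepsize b k)\<^sup>2 / smoothing_param d b k ^ 3 = stepsize b k powr d"
proof -
  have pos: "stepsize b k > 0"
    using assms by (simp add: stepsize_def)
  have "(stepsize b k)\<^sup>2 = stepsize b k powr 2"
    using pos by simp
  moreover have "smoothing_param d b k ^ 3 = stepsize b k powr (3 * (- d / 3 + 2 / 3))"
    using pos by (simp add: smoothing_param_def powr_power)
  moreover have "2 - 3 * (- d / 3 + 2 / 3) = d"
    by simp
  ultimately show ?thesis
    by (metis powr_diff)
qed

text \<open>The squared distance between gradient and subgradient is of this order, whence the
  second term of \<open>rate\<close>.\<close>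

lemma smoothing_param_sq:
  assumes "k \<ge> 1"
  shows "(smoothing_param d b k)\<^sup>2 = real k powr (- (2 * b * (2 - d) / 3))"
proof -
  have "(smoothing_param d b k)\<^sup>2 = real k powr (2 * (- b * (- d / 3 + 2 / 3)))"
    using assms by (simp add: stepsize_def smoothing_param_def powr_powr powr_power)
  also have "2 * (- b * (- d / 3 + 2 / 3)) = - (2 * b * (2 - d) / 3)"
    by (simp add: field_simps)
  finally show ?thesis .
qed

lemma not_summable_stepsize: "b < 1 \<Longrightarrow> \<not> summable (\<lambda>k. stepsize b (Suc k))"
  using summable_Suc_iff[of "\<lambda>k. real k powr (- b)"] summable_real_powr_iff[of "- b"]
  by (simp add: stepsize_def)

lemma summable_stepsize_powr: "1 < b * d \<Longrightarrow> summable (\<lambda>k. stepsize b (Suc k) powr d)"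
  using summable_Suc_iff[of "\<lambda>k. real k powr (- (b * d))"] summable_real_powr_iff[of "- (b * d)"]
  by (simp add: stepsize_def powr_powr)

text \<open>The first term of the minimum suffices: d at most 7/5 gives b > 1/d >= 5/7.\<close>

lemma rate_le:
  assumes "admissible d b"
  shows "rate d b \<le> 2 / 7"
proof -
  have "5 / 7 \<le> 1 / d"
    using admissibleD[OF assms] by (simp add: field_simps)
  moreover have "1 / d < b"
    using assms by (simp add: admissible_def)
  ultimately have "1 - b \<le> 2 / 7"
    by linarith
  then show ?thesis
    unfolding rate_def by (rule min.coboundedI1)
qed

section \<open>Rate for the subgradients\<close>

context smoothed_stochastic_gradient
begin

theorem ssg_subgradient_rate:
  assumes adm: "admissible d b"
    and run: "ssg_run M D sg (stepsize b) (smoothing_param d b) x1 \<xi> x"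
    and sub: "subgradients_along M f ft E1 E2 (smoothing_param d b) x y g"
  shows "\<And>k. k \<ge> 1 \<Longrightarrow> integrable M (\<lambda>\<omega>. (norm (g k \<omega>))\<^sup>2)"
    and "\<epsilon> > 0 \<Longrightarrow> (\<lambda>T. MIN k\<in>{1..T}. \<integral>\<omega>. (norm (g k \<omega>))\<^sup>2 \<partial>M) \<in> O(\<lambda>T. real T powr (- rate d b + \<epsilon>))"
proof -
  interpret prob_space M
    using run by (simp add: ssg_run_def)
  let ?\<mu> = "smoothing_param d b"
  define h where "h k \<omega> = gradient (\<lambda>z. ft z (?\<mu> k)) (x k \<omega>)" for k \<omega>
  define a where "a k = expectation (\<lambda>\<omega>. (norm (h k \<omega>))\<^sup>2)" for k
  have int_h: "integrable M (\<lambda>\<omega>. (norm (h k \<omega>))\<^sup>2)" if "k \<ge> 1" for k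
    unfolding h_def by (rule ssg_step(1)[OF run that ssg_integrable[OF run that]])
  have bound: "(norm (g k \<omega>))\<^sup>2 \<le> 2 * (norm (h k \<omega>))\<^sup>2 + 2 * E2\<^sup>2 * (?\<mu> k)\<^sup>2"
    if "k \<ge> 1" "\<omega> \<in> space M" for k \<omega>
  proof -
    have "norm (h k \<omega> - g k \<omega>) \<le> E2 * ?\<mu> k"
      using sub that by (simp add: subgradients_along_def h_def)
    then have "norm (g k \<omega>) \<le> norm (h k \<omega>) + E2 * ?\<mu> k"
      using norm_triangle_ineq2[of "g k \<omega>" "h k \<omega>"] norm_minus_commute[of "h k \<omega>" "g k \<omega>"] by linarith
    then have "(norm (g k \<omega>))\<^sup>2 \<le> (norm (h k \<omega>) + E2 * ?\<mu> k)\<^sup>2"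
      by (rule power_mono) simp
    also have "\<dots> \<le> 2 * (norm (h k \<omega>))\<^sup>2 + 2 * (E2 * ?\<mu> k)\<^sup>2"
      using sum_squares_bound[of "norm (h k \<omega>)" "E2 * ?\<mu> k"] by (simp add: power2_sum)
    finally show ?thesis
      by (simp add: power_mult_distrib)
  qed
  show int_g: "integrable M (\<lambda>\<omega>. (norm (g k \<omega>))\<^sup>2)" if k: "k \<ge> 1" for k
  proof (rule Bochner_Integration.integrable_bound)
    show "integrable M (\<lambda>\<omega>. 2 * (norm (h k \<omega>))\<^sup>2 + 2 * E2\<^sup>2 * (?\<mu> k)\<^sup>2)"
      using int_h[OF k] by simp
    have "g k \<in> borel_measurable M"
      using sub k by (simp add: subgradients_along_def)
    then show "(\<lambda>\<omega>. (norm (g k \<omega>))\<^sup>2) \<in> borel_measurable M"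
      by simp
    show "AE \<omega> in M. norm ((norm (g k \<omega>))\<^sup>2) \<le> norm (2 * (norm (h k \<omega>))\<^sup>2 + 2 * E2\<^sup>2 * (?\<mu> k)\<^sup>2)"
      using bound[OF k] by (intro AE_I2) simp
  qed
  have E_g: "expectation (\<lambda>\<omega>. (norm (g k \<omega>))\<^sup>2) \<le> 2 * a k + 2 * E2\<^sup>2 * real k powr (- (2 * b * (2 - d) / 3))"
    if k: "k \<ge> 1" for k
  proof -
    have "expectation (\<lambda>\<omega>. (norm (g k \<omega>))\<^sup>2) \<le> expectation (\<lambda>\<omega>. 2 * (norm (h k \<omega>))\<^sup>2 + 2 * E2\<^sup>2 * (?\<mu> k)\<^sup>2)"
      using int_h[OF k] bound[OF k] by (intro integral_mono[OF int_g[OF k]]) auto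
    also have "\<dots> = 2 * a k + 2 * E2\<^sup>2 * (?\<mu> k)\<^sup>2"
      using int_h[OF k] by (simp add: a_def prob_space)
    finally show ?thesis
      by (simp add: smoothing_param_sq[OF k])
  qed
  \<comment> \<open>The finite noise sum in the telescoped bound is replaced by the whole convergent
    series, making the constant independent of T.\<close>
  define K where "K = ft x1 (?\<mu> 1) - m + (C + C1) * ?\<mu> 1 + C0 * G\<^sup>2 / 2 * (\<Sum>k. stepsize b (Suc k) powr d)"
  have sum_a: "(\<Sum>k=1..T. real k powr (- b) * a k) \<le> K" for T
  proof -
    have "(\<Sum>k=1..T. (stepsize b k)\<^sup>2 / ?\<mu> k ^ 3) = (\<Sum>k=1..T. stepsize b k powr d)"
      by (intro sum.cong) (simp_all add: stepsize_sq_div_smoothing_param_cube)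
    also have "\<dots> = (\<Sum>k<T. stepsize b (Suc k) powr d)"
      by (simp add: sum.atLeast1_atMost_eq)
    also have "\<dots> \<le> (\<Sum>k. stepsize b (Suc k) powr d)"
      using admissibleD(5)[OF adm] by (intro sum_le_suminf summable_stepsize_powr) auto
    finally have "C0 * G\<^sup>2 / 2 * (\<Sum>k=1..T. (stepsize b k)\<^sup>2 / ?\<mu> k ^ 3)
        \<le> C0 * G\<^sup>2 / 2 * (\<Sum>k. stepsize b (Suc k) powr d)"
      using C0_nonneg by (intro mult_left_mono) auto
    with ssg_weighted_gradient_sum[OF run, of T] show ?thesis
      by (simp add: K_def a_def h_def stepsize_def)
  qed
  show "(\<lambda>T. MIN k\<in>{1..T}. expectation (\<lambda>\<omega>. (norm (g k \<omega>))\<^sup>2)) \<in> O(\<lambda>T. real T powr (- rate d b + \<epsilon>))"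
    if "\<epsilon> > 0"
    unfolding rate_def
    by (rule Min_bigo_powr[where a = a and c = "2 * E2\<^sup>2" and K = K])
       (use admissibleD[OF adm] that E_g sum_a in auto)
qed

end

section \<open>Assembly and the best exponent\<close>

theorem corollary3p3:
  fixes f :: "real ^ 'n \<Rightarrow> real"
    and ft :: "real ^ 'n \<Rightarrow> real \<Rightarrow> real"
    and sg :: "real ^ 'n \<Rightarrow> real ^ 'm \<Rightarrow> real \<Rightarrow> real ^ 'n"
    and D :: "(real ^ 'm) measure"
    and G C C0 C1 E1 E2 :: real
  assumes "locally_lipschitz f"
    and "bdd_below (range f)"
    and "smoothing_function f ft"
    and "prob_space D" and "sets D = sets borel"
    and "\<And>\<mu>. \<mu> > 0 \<Longrightarrow> (\<lambda>(x, s). sg x s \<mu>) \<in> borel_measurable (borel \<Otimes>\<^sub>M borel)"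
    and "\<And>x \<mu>. \<mu> > 0 \<Longrightarrow> integrable D (\<lambda>s. sg x s \<mu>) \<and>
           prob_space.expectation D (\<lambda>s. sg x s \<mu>) = gradient (\<lambda>z. ft z \<mu>) x"
    and "G > 0"
    and "\<And>x \<mu>. \<mu> > 0 \<Longrightarrow> integrable D (\<lambda>s. (norm (sg x s \<mu>))\<^sup>2) \<and>
           prob_space.expectation D (\<lambda>s. (norm (sg x s \<mu>))\<^sup>2) \<le> G\<^sup>2 / \<mu>\<^sup>2"
    and "C > 0"
    and "\<And>x \<mu>. \<mu> > 0 \<Longrightarrow> \<bar>f x - ft x \<mu>\<bar> \<le> C * \<mu>"
    and "C0 > 0"
    and "\<And>\<mu>. \<mu> > 0 \<Longrightarrow> (C0 / \<mu>)-lipschitz_on UNIV (gradient (\<lambda>z. ft z \<mu>))"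
    and "C1 > 0"
    and "\<And>x \<mu> \<mu>'. \<mu> > 0 \<Longrightarrow> \<mu>' > 0 \<Longrightarrow> \<bar>ft x \<mu>' - ft x \<mu>\<bar> \<le> C1 * \<bar>\<mu>' - \<mu>\<bar>"
    and "E1 > 0" and "E2 > 0"
    and "\<And>x \<mu>. \<mu> > 0 \<Longrightarrow> \<exists>y \<in> cball x (E1 * \<mu>). \<exists>g \<in> clarke_subdifferential f y.
           norm (gradient (\<lambda>z. ft z \<mu>) x - g) \<le> E2 * \<mu>"
  shows
    "(\<forall>d b. admissible d b \<longrightarrow>
        \<not> summable (\<lambda>k. stepsize b (Suc k)) \<and>
        summable (\<lambda>k. stepsize b (Suc k) powr d) \<and>
        (\<forall>(M :: 'w measure) x1 \<xi> x y g.
           ssg_run M D sg (stepsize b) (smoothing_param d b) x1 \<xi> x \<and>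
           subgradients_along M f ft E1 E2 (smoothing_param d b) x y g \<longrightarrow>
           (\<forall>k\<ge>1. integrable M (\<lambda>\<omega>. (norm (g k \<omega>))\<^sup>2)) \<and>
           (\<forall>\<epsilon>>0. (\<lambda>T. MIN k\<in>{1..T}. prob_space.expectation M (\<lambda>\<omega>. (norm (g k \<omega>))\<^sup>2))
                     \<in> O(\<lambda>T. real T powr (- rate d b + \<epsilon>)))))
     \<and> (\<forall>d b. admissible d b \<longrightarrow> rate d b \<le> 2 / 7)
     \<and> (\<forall>\<delta>>0. \<exists>d b. admissible d b \<and> rate d b > 2 / 7 - \<delta> \<and>
        (\<forall>(M :: 'w measure) x1 \<xi> x y g.
           ssg_run M D sg (stepsize b) (smoothing_param d b) x1 \<xi> x \<and>
           subgradients_along M f ft E1 E2 (smoothing_param d b) x y g \<longrightarrow>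
           (\<lambda>T. MIN k\<in>{1..T}. prob_space.expectation M (\<lambda>\<omega>. (norm (g k \<omega>))\<^sup>2))
             \<in> O(\<lambda>T. real T powr (- 2 / 7 + \<delta>))))"
proof -
  obtain m where m: "\<And>x. m \<le> f x"
    using assms(2) by (auto simp: bdd_below_def)
  have diff: "\<And>x \<mu>. \<mu> > 0 \<Longrightarrow> (\<lambda>z. ft z \<mu>) differentiable (at x)"
    using assms(3) by (simp add: smoothing_function_def)
  interpret smoothed_stochastic_gradient f ft sg D G C C0 C1 m
    by unfold_locales
       (assumption | rule m diff assms(6,11,13,15) assms(7)[THEN conjunct1] assms(7)[THEN conjunct2]
          assms(9)[THEN conjunct1] assms(9)[THEN conjunct2]
          less_imp_le[OF assms(10)] less_imp_le[OF assms(12)] less_imp_le[OF assms(14)])+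
  have best: "\<exists>d b. admissible d b \<and> rate d b > 2 / 7 - \<delta> \<and>
        (\<forall>(M :: 'w measure) x1 \<xi> x y g.
           ssg_run M D sg (stepsize b) (smoothing_param d b) x1 \<xi> x \<and>
           subgradients_along M f ft E1 E2 (smoothing_param d b) x y g \<longrightarrow>
           (\<lambda>T. MIN k\<in>{1..T}. prob_space.expectation M (\<lambda>\<omega>. (norm (g k \<omega>))\<^sup>2))
             \<in> O(\<lambda>T. real T powr (- 2 / 7 + \<delta>)))" if "\<delta> > 0" for \<delta> :: real
  proof -
    \<comment> \<open>Take d = 7/5 and b = 5/7 + \<eta>: \<eta> > 0 keeps b above 1/d, \<eta> <= 1/7
      keeps b below 1, and \<eta> < \<delta> leaves room for \<epsilon>.\<close>
    define \<eta> where "\<eta> = min (\<delta> / 2) (1 / 7)"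
    have \<eta>: "0 < \<eta>" "\<eta> \<le> 1 / 7" "\<eta> < \<delta>"
      using that by (auto simp: \<eta>_def)
    have adm: "admissible (7 / 5) (5 / 7 + \<eta>)"
      using \<eta> by (simp add: admissible_def)
    \<comment> \<open>The second term is 2/7 + 2\<eta>/5, so the minimum is 1 - b; both terms tend
      to 2/7 as \<eta> vanishes.\<close>
    have rate: "rate (7 / 5) (5 / 7 + \<eta>) = 2 / 7 - \<eta>"
      using \<eta> by (simp add: rate_def min_def)
    \<comment> \<open>Choosing \<epsilon> = \<delta> - \<eta> makes the exponent exactly the
      required one.\<close>
    have exponent: "- rate (7 / 5) (5 / 7 + \<eta>) + (\<delta> - \<eta>) = - 2 / 7 + \<delta>"
      by (simp add: rate)
    have "rate (7 / 5) (5 / 7 + \<eta>) > 2 / 7 - \<delta>" "\<delta> - \<eta> > 0"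
      using \<eta> by (simp_all add: rate)
    then show ?thesis
      using adm ssg_subgradient_rate(2)[OF adm, where \<epsilon> = "\<delta> - \<eta>", unfolded exponent]
      by blast
  qed
  show ?thesis
    by (intro conjI allI impI; (elim conjE)?; rule not_summable_stepsize[OF admissibleD(4)]
        summable_stepsize_powr[OF admissibleD(5)] ssg_subgradient_rate rate_le best; assumption)
qed

end
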